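(* Let $\mathbb{K}$ be a field, $R=\mathbb{K}[x_1,\dots,x_n]$ with $n\ge 1$, let $W=[w_1,\dots,w_n]$ be a vector of positive integers, let $\prec_W$ be a generalized weighted degree ordering on the monomials of $R$ with weight vector $W$, and let $I\subseteq R$ be an ideal with initial ideal $\bar I=\mathrm{in}_{\prec_W}(I)$. Let $d=\mathrm{lcm}(w_1,\dots,w_n)$, and let $H_{R/\bar I}$, $P^W_{R/\bar I}=\{P_0,\dots,P_{d-1}\}$ and $\mathrm{ri}^W(R/\bar I)$ be the Hilbert function, the Hilbert quasi-polynomial and the generalized regularity index of $R/\bar I$ with respect to $W$. The following are equivalent: (i) no two distinct monomials in the Hilbert staircase $\mathcal{N}_{\prec_W}(I)$ have the same weight; (ii) $H_{R/\bar I}(k)\in\{0,1\}$ for all integers $0\le k<\mathrm{ri}^W(R/\bar I)$, and each $P_i$ ($0\le i\le d-1$) is the constant polynomial $0$ or the constant polynomial $1$.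
   Context: Weights: $x_i$ has weight $w_i\in\mathbb{N}_+$ (positive integers), and $\mathrm{w}(x_1^{\alpha_1}\cdots x_n^{\alpha_n})=\alpha_1w_1+\cdots+\alpha_nw_n$. Generalized weighted degree ordering: given a monomial ordering $\prec_{\mathcal M}$ on the monomials of $R$, $X^\alpha\prec_W X^\beta$ iff either $\mathrm{w}(X^\alpha)<\mathrm{w}(X^\beta)$, or $\mathrm{w}(X^\alpha)=\mathrm{w}(X^\beta)$ and $X^\alpha\prec_{\mathcal M}X^\beta$. Initial ideal and staircase: $\mathrm{in}_{\prec_W}(I)$ is the ideal generated by the leading terms with respect to $\prec_W$ of the nonzero elements of $I$; $\mathcal{N}_{\prec_W}(I)$ is the set of monomials of $R$ that are not the leading monomial of any polynomial in $I$. Hilbert function: an ideal $J\subseteq R$ is $W$-homogeneous if it is generated by polynomials each of whose nonzero terms all have the same weight (monomial ideals are $W$-homogeneous). For such $J$, $(R/J)_k$ is the image in $R/J$ of the $\mathbb{K}$-span of the monomials of weight $k$, and $H_{R/J}(k)=\dim_{\mathbb{K}}(R/J)_k$ for $k\in\mathbb{N}$ (with $0\in\mathbb{N}$). Hilbert quasi-polynomial: with $d=\mathrm{lcm}(w_1,\dots,w_n)$, $P^W_{R/J}=\{P_0,\dots,P_{d-1}\}$ is the unique family of polynomials in $\mathbb{Q}[x]$ such that $H_{R/J}(k)=P_i(k)$ for all sufficiently large $k$ with $k\equiv i \pmod d$; write $P^W_{R/J}(k)=P_i(k)$ when $k\equiv i\pmod d$. The generalized regularity index $\mathrm{ri}^W(R/J)$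 is the least $k_0\in\mathbb{N}$ such that $H_{R/J}(k)=P^W_{R/J}(k)$ for all $k\ge k_0$. *)

theory Defs
  imports
    "HOL-Library.Poly_Mapping"
    "HOL-Computational_Algebra.Polynomial"
    "HOL-Algebra.QuotRing"
    "Jordan_Normal_Form.VS_Connect"
begin

text \<open>
  The variables are indexed by a finite type, which is nonempty, so that the number of variables is
  an arbitrary positive integer. A monomial is represented by its exponent vector, and the product
  of monomials is the sum of exponent vectors. The multiplication of \<^typ>\<open>('n \<Rightarrow>\<^sub>0 nat) \<Rightarrow>\<^sub>0 'k\<close> is convolution, so
  that \<^term>\<open>class_ring :: (('n::finite \<Rightarrow>\<^sub>0 nat) \<Rightarrow>\<^sub>0 'k::field) ring\<close> is the polynomial ring.
\<close>

type_synonym 'n monom = "'n \<Rightarrow>\<^sub>0 nat"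
type_synonym ('n, 'k) mpoly = "'n monom \<Rightarrow>\<^sub>0 'k"

abbreviation mpoly_ring :: "('n::finite, 'k::field) mpoly ring" where
  "mpoly_ring \<equiv> class_ring"

definition weight :: "('n::finite \<Rightarrow> nat) \<Rightarrow> 'n monom \<Rightarrow> nat" where
  "weight w m = (\<Sum>i\<in>UNIV. Poly_Mapping.lookup m i * w i)"

text \<open>Orderings are given by their strict part.\<close>

definition monomial_ordering :: "('n::finite monom \<Rightarrow> 'n monom \<Rightarrow> bool) \<Rightarrow> bool" where
  "monomial_ordering prec \<longleftrightarrow>
     irreflp prec \<and> transp prec \<and> totalp prec \<and> wfp prec \<and>
     (\<forall>a b c. prec a b \<longrightarrow> prec (a + c) (b + c))"

definition weighted_ordering ::
    "('n::finite \<Rightarrow> nat) \<Rightarrow> ('n monom \<Rightarrow> 'n monom \<Rightarrow> bool) \<Rightarrow> 'n monom \<Rightarrow> 'n monom \<Rightarrow> bool" where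
  "weighted_ordering w prec a b \<longleftrightarrow>
     weight w a < weight w b \<or> weight w a = weight w b \<and> prec a b"

definition leading_monomial ::
    "('n::finite monom \<Rightarrow> 'n monom \<Rightarrow> bool) \<Rightarrow> ('n, 'k::field) mpoly \<Rightarrow> 'n monom" where
  "leading_monomial prec f =
     (THE m. m \<in> Poly_Mapping.keys f \<and> (\<forall>m'\<in>Poly_Mapping.keys f. m' \<noteq> m \<longrightarrow> prec m' m))"

definition leading_term ::
    "('n::finite monom \<Rightarrow> 'n monom \<Rightarrow> bool) \<Rightarrow> ('n, 'k::field) mpoly \<Rightarrow> ('n, 'k) mpoly" where
  "leading_term prec f =
     Poly_Mapping.single (leading_monomial prec f)
       (Poly_Mapping.lookup f (leading_monomial prec f))"

definition initial_ideal ::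
    "('n::finite monom \<Rightarrow> 'n monom \<Rightarrow> bool) \<Rightarrow> ('n, 'k::field) mpoly set \<Rightarrow> ('n, 'k) mpoly set" where
  "initial_ideal prec I = Idl\<^bsub>mpoly_ring\<^esub> {leading_term prec f |f. f \<in> I \<and> f \<noteq> 0}"

definition staircase ::
    "('n::finite monom \<Rightarrow> 'n monom \<Rightarrow> bool) \<Rightarrow> ('n, 'k::field) mpoly set \<Rightarrow> 'n monom set" where
  "staircase prec I = {m. \<not> (\<exists>f\<in>I. f \<noteq> 0 \<and> leading_monomial prec f = m)}"

definition mpoly_space :: "('k::field, ('n::finite, 'k) mpoly) module" where
  "mpoly_space =
     \<lparr>carrier = UNIV, mult = (*), one = 1, zero = 0, add = (+),
      smult = (\<lambda>c f. Poly_Mapping.single 0 c * f)\<rparr>"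

definition quotient_space ::
    "('n::finite, 'k::field) mpoly set \<Rightarrow> ('k, ('n, 'k) mpoly set) module" where
  "quotient_space J = (let Q = mpoly_ring Quot J in
     \<lparr>carrier = carrier Q, mult = mult Q, one = one Q, zero = zero Q, add = add Q,
      smult = (\<lambda>c A. (J +>\<^bsub>mpoly_ring\<^esub> Poly_Mapping.single 0 c) \<otimes>\<^bsub>Q\<^esub> A)\<rparr>)"

definition quotient_part ::
    "('n::finite \<Rightarrow> nat) \<Rightarrow> ('n, 'k::field) mpoly set \<Rightarrow> nat \<Rightarrow> ('n, 'k) mpoly set set" where
  "quotient_part w J k =
     (\<lambda>f. J +>\<^bsub>mpoly_ring\<^esub> f) `
       LinearCombinations.module.span (class_ring :: 'k ring) mpoly_space
         {Poly_Mapping.single m 1 |m. weight w m = k}"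

definition hilbert_function ::
    "('n::finite \<Rightarrow> nat) \<Rightarrow> ('n, 'k::field) mpoly set \<Rightarrow> nat \<Rightarrow> nat" where
  "hilbert_function w J k =
     vectorspace.dim (class_ring :: 'k ring) (quotient_space J\<lparr>carrier := quotient_part w J k\<rparr>)"

definition period :: "('n::finite \<Rightarrow> nat) \<Rightarrow> nat" where
  "period w = Lcm (Set.range w)"

text \<open>
  The uniqueness of a quasi-polynomial is the uniqueness of each of its components; the component
  of index \<^term>\<open>i\<close> is meaningful for \<^term>\<open>i < period w\<close>.
\<close>

definition hilbert_quasi_poly ::
    "('n::finite \<Rightarrow> nat) \<Rightarrow> ('n, 'k::field) mpoly set \<Rightarrow> nat \<Rightarrow> rat poly" where
  "hilbert_quasi_poly w J i =
     (THE p. \<forall>\<^sub>F k in sequentially. k mod period w = i \<longrightarrow>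
        of_nat (hilbert_function w J k) = poly p (of_nat k))"

definition regularity_index :: "('n::finite \<Rightarrow> nat) \<Rightarrow> ('n, 'k::field) mpoly set \<Rightarrow> nat" where
  "regularity_index w J =
     (LEAST k0. \<forall>k\<ge>k0. of_nat (hilbert_function w J k) =
        poly (hilbert_quasi_poly w J (k mod period w)) (of_nat k))"

end

theory Submission
  imports Defs
begin

text \<open>
  The staircase \<open>N\<close> is closed under divisors, and \<open>J\<close> is spanned by the monomials outside \<open>N\<close>, so the
  monomials of weight \<open>k\<close> in \<open>N\<close> form a basis of \<open>(R/J)\<^sub>k\<close>. Hence (i) says that the Hilbert function
  \<open>H\<close> takes only the values 0 and 1. For every divisor-closed set of monomials, the number of
  elements of weight \<open>k\<close> is a quasi-polynomial for large \<open>k\<close>: for a variable \<open>x\<^sub>i\<close>, Dickson's lemma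
  makes multiplication by \<open>x\<^sub>i\<close> preserve the set as soon as the exponent of \<open>x\<^sub>i\<close> is large, so
  \<open>H(k + w\<^sub>i) - H(k)\<close> only involves finitely many slices with a fixed exponent of \<open>x\<^sub>i\<close>, and one
  concludes by induction on the number of variables. So the components \<open>P\<^sub>i\<close> and the regularity
  index are meaningful, and a polynomial that takes values in \<open>{0, 1}\<close> at infinitely many integers is
  one of the constants 0 and 1.
\<close>

section \<open>Quasi-polynomials\<close>

text \<open>In \<open>(x + d) ^ Suc n - x ^ Suc n\<close> the highest term is
  \<open>of_nat (Suc n) * d * x ^ n\<close>. The lower powers have antidifferences by strong
  induction, so they can be subtracted before dividing by the nonzero factor.\<close>

lemma poly_antidifference_monom:
  fixes d :: rat
  assumes "d \<noteq> 0"
  shows "\<exists>p. \<forall>x. poly p (x + d) - poly p x = x ^ n"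
proof (induction n rule: less_induct)
  case (less n)
  then obtain P where P: "\<And>j x. j < n \<Longrightarrow> poly (P j) (x + d) - poly (P j) x = x ^ j"
    by metis
  \<comment> \<open>\<open>c j\<close> is the coefficient of \<open>x ^ j\<close> in the binomial
    expansion of \<open>(x + d) ^ Suc n\<close>; only those with \<open>j < n\<close> need
    correcting.\<close>
  define c where "c j = of_nat (Suc n choose j) * d ^ (Suc n - j)" for j
  define p where "p = Polynomial.smult (1 / (of_nat (Suc n) * d))
    (monom 1 (Suc n) - (\<Sum>j<n. Polynomial.smult (c j) (P j)))"
  have "poly p (x + d) - poly p x = x ^ n" for x
  proof -
    have "(x + d) ^ Suc n = (\<Sum>j\<le>Suc n. c j * x ^ j)"
      unfolding binomial_ring c_def by (simp add: mult_ac)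
    also have "\<dots> = x ^ Suc n + of_nat (Suc n) * d * x ^ n + (\<Sum>j<n. c j * x ^ j)"
      by (simp add: lessThan_Suc_atMost[symmetric] c_def)
    finally have "(x + d) ^ Suc n - x ^ Suc n - (\<Sum>j<n. c j * x ^ j) = of_nat (Suc n) * d * x ^ n"
      by simp
    moreover have "(\<Sum>j<n. c j * x ^ j)
        = (\<Sum>j<n. c j * poly (P j) (x + d)) - (\<Sum>j<n. c j * poly (P j) x)"
      using P by (simp add: sum_subtractf[symmetric] right_diff_distrib[symmetric])
    moreover have "poly p (x + d) - poly p x = ((x + d) ^ Suc n - x ^ Suc n
        - ((\<Sum>j<n. c j * poly (P j) (x + d)) - (\<Sum>j<n. c j * poly (P j) x))) / (of_nat (Suc n) * d)"
      unfolding p_def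
      by (simp add: poly_monom poly_sum diff_divide_distrib del: power_Suc of_nat_Suc)
    ultimately show ?thesis
      using assms by (simp del: power_Suc of_nat_Suc)
  qed
  then show ?case by blast
qed

lemma poly_antidifference:
  fixes q :: "rat poly"
  assumes "d \<noteq> 0"
  shows "\<exists>p. \<forall>x. poly p (x + d) - poly p x = poly q x"
proof -
  obtain P where P: "\<And>n x. poly (P n) (x + d) - poly (P n) x = x ^ n"
    using poly_antidifference_monom[OF assms] by metis
  have "poly (\<Sum>i\<le>degree q. Polynomial.smult (coeff q i) (P i)) (x + d)
      - poly (\<Sum>i\<le>degree q. Polynomial.smult (coeff q i) (P i)) x = poly q x" for x
    using P by (simp add: poly_sum sum_subtractf[symmetric] right_diff_distrib[symmetric] poly_altdef[of q])
  then show ?thesis by blast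
qed

text \<open>The difference has infinitely many natural numbers among its roots, and the embedding of
  the naturals into the rationals is injective, so the difference is zero.\<close>

lemma poly_eqI_frequently:
  fixes p q :: "rat poly"
  assumes "\<And>K. \<exists>k\<ge>K::nat. poly p (of_nat k) = poly q (of_nat k)"
  shows "p = q"
proof (rule ccontr)
  assume "p \<noteq> q"
  then have "finite {x. poly (p - q) x = 0}"
    using poly_roots_finite[of "p - q"] by simp
  then have "finite {k::nat. poly (p - q) (of_nat k) = 0}"
    using finite_vimageI[of "{x. poly (p - q) x = 0}" "of_nat :: nat \<Rightarrow> rat"]
    by (simp add: vimage_def inj_def)
  moreover have "infinite {k::nat. poly (p - q) (of_nat k) = 0}"
    using assms by (auto simp: infinite_nat_iff_unbounded_le)
  ultimately show False by simp
qed

section \<open>Closure properties of eventual quasi-polynomials\<close>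

text \<open>Each residue class has its own polynomial. The index \<open>i\<close> ranges over all
  naturals; for \<open>d > 0\<close> the classes with \<open>i \<ge> d\<close> are empty, so closure
  proofs carry no bound on \<open>i\<close>.\<close>

definition eventually_quasi_poly :: "nat \<Rightarrow> (nat \<Rightarrow> rat) \<Rightarrow> bool" where
  "eventually_quasi_poly d f \<longleftrightarrow>
     (\<forall>i. \<exists>p. \<forall>\<^sub>F k in sequentially. k mod d = i \<longrightarrow> f k = poly p (of_nat k))"

lemma eventually_quasi_poly_cong:
  assumes "eventually_quasi_poly d f" "\<forall>\<^sub>F k in sequentially. f k = g k"
  shows "eventually_quasi_poly d g"
  unfolding eventually_quasi_poly_def
proof
  fix i
  obtain p where "\<forall>\<^sub>F k in sequentially. k mod d = i \<longrightarrow> f k = poly p (of_nat k)"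
    using assms(1) unfolding eventually_quasi_poly_def by blast
  with assms(2) have "\<forall>\<^sub>F k in sequentially. k mod d = i \<longrightarrow> g k = poly p (of_nat k)"
    by eventually_elim simp
  then show "\<exists>p. \<forall>\<^sub>F k in sequentially. k mod d = i \<longrightarrow> g k = poly p (of_nat k)" ..
qed

lemma eventually_quasi_poly_zero: "eventually_quasi_poly d (\<lambda>k. 0)"
  unfolding eventually_quasi_poly_def by (rule allI, rule exI[where x = 0]) simp

lemma eventually_quasi_poly_add:
  assumes "eventually_quasi_poly d f" "eventually_quasi_poly d g"
  shows "eventually_quasi_poly d (\<lambda>k. f k + g k)"
  unfolding eventually_quasi_poly_def
proof
  fix i
  obtain p where p: "\<forall>\<^sub>F k in sequentially. k mod d = i \<longrightarrow> f k = poly p (of_nat k)"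
    using assms(1) unfolding eventually_quasi_poly_def by blast
  obtain q where "\<forall>\<^sub>F k in sequentially. k mod d = i \<longrightarrow> g k = poly q (of_nat k)"
    using assms(2) unfolding eventually_quasi_poly_def by blast
  with p have "\<forall>\<^sub>F k in sequentially. k mod d = i \<longrightarrow> f k + g k = poly (p + q) (of_nat k)"
    by eventually_elim simp
  then show "\<exists>p. \<forall>\<^sub>F k in sequentially. k mod d = i \<longrightarrow> f k + g k = poly p (of_nat k)" ..
qed

lemma eventually_quasi_poly_uminus:
  assumes "eventually_quasi_poly d f"
  shows "eventually_quasi_poly d (\<lambda>k. - f k)"
  unfolding eventually_quasi_poly_def
proof
  fix i
  obtain p where "\<forall>\<^sub>F k in sequentially. k mod d = i \<longrightarrow> f k = poly p (of_nat k)"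
    using assms unfolding eventually_quasi_poly_def by blast
  then have "\<forall>\<^sub>F k in sequentially. k mod d = i \<longrightarrow> - f k = poly (- p) (of_nat k)"
    by eventually_elim simp
  then show "\<exists>p. \<forall>\<^sub>F k in sequentially. k mod d = i \<longrightarrow> - f k = poly p (of_nat k)" ..
qed

lemma eventually_quasi_poly_sum:
  assumes "\<And>a. a \<in> A \<Longrightarrow> eventually_quasi_poly d (f a)"
  shows "eventually_quasi_poly d (\<lambda>k. \<Sum>a\<in>A. f a k)"
  using assms
  by (induction A rule: infinite_finite_induct)
    (auto intro: eventually_quasi_poly_zero eventually_quasi_poly_add)

lemma eventually_quasi_poly_shift:
  assumes "eventually_quasi_poly d f"
  shows "eventually_quasi_poly d (\<lambda>k. f (k + c))"
  unfolding eventually_quasi_poly_def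
proof
  fix i
  \<comment> \<open>If \<open>k\<close> lies in class \<open>i\<close>, then \<open>k + c\<close>
    lies in class \<open>(i + c) mod d\<close>; the polynomial of that class is then composed with
    \<open>x + c\<close>.\<close>
  obtain p where "\<forall>\<^sub>F k in sequentially. k mod d = (i + c) mod d \<longrightarrow> f k = poly p (of_nat k)"
    using assms unfolding eventually_quasi_poly_def by blast
  then have "\<forall>\<^sub>F k in sequentially.
      (k + c) mod d = (i + c) mod d \<longrightarrow> f (k + c) = poly p (of_nat (k + c))"
    by (rule eventually_compose_filterlim) (rule filterlim_add_const_nat_at_top)
  then have "\<forall>\<^sub>F k in sequentially.
      k mod d = i \<longrightarrow> f (k + c) = poly (pcompose p [:of_nat c, 1:]) (of_nat k)"
    by eventually_elim (auto simp: poly_pcompose add.commute mod_simps)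
  then show "\<exists>p. \<forall>\<^sub>F k in sequentially. k mod d = i \<longrightarrow> f (k + c) = poly p (of_nat k)" ..
qed

text \<open>Iterating the recurrence \<open>d div w\<close> times gives one of step
  \<open>d\<close>, which stays inside a residue class. There the increment is eventually a
  polynomial, and \<open>f\<close> differs from an antidifference of it by a constant.\<close>

lemma eventually_quasi_poly_antidifference:
  assumes "d > 0" and "w dvd d" and step: "\<And>k. f (k + w) = f k + g k"
    and g: "eventually_quasi_poly d g"
  shows "eventually_quasi_poly d f"
  unfolding eventually_quasi_poly_def
proof
  fix i
  have iter: "f (k + n * w) = f k + (\<Sum>j<n. g (k + j * w))" for k n
  proof (induction n)
    case (Suc n)
    then show ?case
      using step[of "k + n * w"] by (simp add: add_ac)
  qed simp
  define h where "h k = (\<Sum>j<d div w. g (k + j * w))" for k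
  have fh: "f (k + d) = f k + h k" for k
    using iter[of k "d div w"] \<open>w dvd d\<close> by (simp add: h_def)
  have "eventually_quasi_poly d h"
    unfolding h_def by (intro eventually_quasi_poly_sum eventually_quasi_poly_shift g)
  then obtain q where "\<forall>\<^sub>F k in sequentially. k mod d = i \<longrightarrow> h k = poly q (of_nat k)"
    unfolding eventually_quasi_poly_def by blast
  then obtain K where K: "\<And>k. k \<ge> K \<Longrightarrow> k mod d = i \<Longrightarrow> h k = poly q (of_nat k)"
    unfolding eventually_sequentially by blast
  obtain p where p: "\<And>x. poly p (x + of_nat d) - poly p x = poly q x"
    using poly_antidifference[of "of_nat d" q] \<open>d > 0\<close> by auto
  show "\<exists>p. \<forall>\<^sub>F k in sequentially. k mod d = i \<longrightarrow> f k = poly p (of_nat k)"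
  proof (cases "i < d")
    case False
    then have "k mod d \<noteq> i" for k
      using \<open>d > 0\<close> by auto
    then show ?thesis by simp
  next
    case True
    \<comment> \<open>A member of class \<open>i\<close> that is at least \<open>K\<close> because
      \<open>d \<ge> 1\<close>. All later members of the class are reached from it in steps of
      \<open>d\<close>.\<close>
    define k0 where "k0 = K * d + i"
    define c where "c = f k0 - poly p (of_nat k0)"
    have "k0 \<ge> K"
      using \<open>d > 0\<close> by (simp add: k0_def trans_le_add1)
    have *: "f (k0 + n * d) - poly p (of_nat (k0 + n * d)) = c" for n
    proof (induction n)
      case (Suc n)
      let ?k = "k0 + n * d"
      have "h ?k = poly q (of_nat ?k)"
        using True \<open>k0 \<ge> K\<close> by (intro K) (auto simp: k0_def)
      then have "f (?k + d) - poly p (of_nat ?k + of_nat d) = f ?k - poly p (of_nat ?k)"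
        using p[of "of_nat ?k"] fh[of ?k] by simp
      then show ?case
        using Suc by (simp add: add_ac)
    qed (simp add: c_def)
    have "f k = poly (p + [:c:]) (of_nat k)" if "k \<ge> k0" "k mod d = i" for k
    proof -
      have "k0 div d \<le> k div d"
        using that by (intro div_le_mono)
      moreover have "k0 mod d = i" using True by (simp add: k0_def)
      ultimately have "k = k0 + (k div d - k0 div d) * d"
        using div_mult_mod_eq[of k0 d] div_mult_mod_eq[of k d] that
        by (simp add: diff_mult_distrib)
      then show ?thesis
        using *[of "k div d - k0 div d"] by simp
    qed
    then show ?thesis
      unfolding eventually_sequentially by blast
  qed
qed

section \<open>Counting monomials in divisor-closed sets\<close>

text \<open>Subsequences are thinned out one coordinate at a time; passing to a further subsequence
  keeps the coordinates already treated monotone.\<close>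

lemma dickson:
  fixes f :: "nat \<Rightarrow> 'n \<Rightarrow> nat"
  assumes "finite S"
  shows "\<exists>r::nat \<Rightarrow> nat. strict_mono r \<and> (\<forall>i\<in>S. mono (\<lambda>t. f (r t) i))"
  using assms
proof (induction S)
  case empty
  have "strict_mono (id :: nat \<Rightarrow> nat)"
    by (simp add: strict_mono_def)
  then show ?case by blast
next
  case (insert i S)
  then obtain r :: "nat \<Rightarrow> nat" where r: "strict_mono r" "\<And>j. j \<in> S \<Longrightarrow> mono (\<lambda>t. f (r t) j)"
    by blast
  obtain s :: "nat \<Rightarrow> nat" where s: "strict_mono s" "mono (\<lambda>t. f (r (s t)) i)"
  proof -
    obtain s :: "nat \<Rightarrow> nat" where s: "strict_mono s" "monoseq (\<lambda>t. f (r (s t)) i)"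
      using seq_monosub[of "\<lambda>t. f (r t) i"] by blast
    show ?thesis
    proof (cases "incseq (\<lambda>t. f (r (s t)) i)")
      case True
      then show ?thesis using s that by blast
    next
      case False
      then have dec: "decseq (\<lambda>t. f (r (s t)) i)"
        using s by (simp add: monoseq_iff)
      \<comment> \<open>A decreasing sequence of naturals is constant once it attains its minimum
        \<open>m\<close>, so dropping the terms before that point makes it increasing as
        well.\<close>
      define m where "m = (LEAST v. \<exists>t. v = f (r (s t)) i)"
      have "\<exists>t. m = f (r (s t)) i"
        unfolding m_def by (rule LeastI[of _ "f (r (s 0)) i"]) blast
      then obtain t0 where t0: "m = f (r (s t0)) i" by blast
      have "f (r (s (t0 + t))) i = m" for t
      proof (rule antisym)
        show "m \<le> f (r (s (t0 + t))) i"
          unfolding m_def by (rule Least_le) blast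
        show "f (r (s (t0 + t))) i \<le> m"
          unfolding t0 using dec by (simp add: decseq_def)
      qed
      then have "mono (\<lambda>t. f (r ((s \<circ> (+) t0) t)) i)"
        by (simp add: mono_def)
      moreover have "strict_mono (s \<circ> (+) t0)"
        using s(1) by (simp add: strict_mono_def)
      ultimately show ?thesis using that by blast
    qed
  qed
  have "mono (\<lambda>t. f ((r \<circ> s) t) j)" if "j \<in> S" for j
    using r(2)[OF that] s(1) by (auto simp: mono_def strict_mono_less_eq)
  then have "\<forall>j\<in>insert i S. mono (\<lambda>t. f ((r \<circ> s) t) j)"
    using s(2) by simp
  moreover have "strict_mono (r \<circ> s)"
    using r(1) s(1) by (rule strict_mono_o)
  ultimately show ?case by blast
qed

lemma weight_add: "weight w (a + b) = weight w a + weight w b"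
  by (simp add: weight_def lookup_add add_mult_distrib sum.distrib)

lemma weight_single: "weight w (Poly_Mapping.single i a) = a * w i"
proof -
  have "weight w (Poly_Mapping.single i a) = (\<Sum>j\<in>UNIV. if j = i then a * w i else 0)"
    unfolding weight_def by (intro sum.cong) (auto simp: lookup_single when_def)
  then show ?thesis by simp
qed

text \<open>Since every \<open>w i\<close> is at least 1, each exponent is bounded by the weight,
  which leaves finitely many exponent vectors.\<close>

lemma finite_weight_eq:
  assumes "\<And>i. w i > 0"
  shows "finite {m. weight w m = k}"
proof -
  have "Poly_Mapping.lookup m i \<le> weight w m" for m i
  proof -
    have "Poly_Mapping.lookup m i \<le> Poly_Mapping.lookup m i * w i"
      using assms[of i] by simp
    also have "\<dots> \<le> weight w m"
      unfolding weight_def by (rule member_le_sum) auto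
    finally show ?thesis .
  qed
  then have "Poly_Mapping.lookup ` {m. weight w m = k} \<subseteq> PiE UNIV (\<lambda>_. {..k})"
    by auto
  then have "finite (Poly_Mapping.lookup ` {m. weight w m = k})"
    by (rule finite_subset) (simp add: finite_PiE)
  then show ?thesis
    by (rule finite_imageD) (simp add: inj_on_def lookup_inject)
qed

lemma card_fibres_lessThan:
  fixes g :: "'a \<Rightarrow> nat"
  assumes "finite X"
  shows "card {m \<in> X. g m < A} = (\<Sum>a<A. card {m \<in> X. g m = a})"
proof -
  have "{m \<in> X. g m < A} = (\<Union>a<A. {m \<in> X. g m = a})"
    by auto
  then show ?thesis
    using assms by (simp only:) (subst card_UN_disjoint, auto)
qed

section \<open>The recurrence for the number of monomials of a given weight\<close>

text \<open>Otherwise there are elements of \<open>D\<close> with arbitrarily large exponent at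
  \<open>i\<close> that leave \<open>D\<close> under multiplication by the variable
  \<open>i\<close>. By Dickson's lemma, such a product divides a later element of the sequence, so
  it lies in \<open>D\<close> after all.\<close>

lemma down_closed_shift_stable:
  fixes D :: "'n::finite monom set"
  assumes const: "\<And>m j. m \<in> D \<Longrightarrow> j \<notin> S \<Longrightarrow> Poly_Mapping.lookup m j = c j"
    and down: "\<And>m m'. m \<in> D \<Longrightarrow> (\<And>j. j \<in> S \<Longrightarrow> Poly_Mapping.lookup m' j \<le> Poly_Mapping.lookup m j) \<Longrightarrow>
      (\<And>j. j \<notin> S \<Longrightarrow> Poly_Mapping.lookup m' j = c j) \<Longrightarrow> m' \<in> D"
    and "i \<in> S"
  shows "\<exists>A. \<forall>m\<in>D. A \<le> Poly_Mapping.lookup m i \<longrightarrow> m + Poly_Mapping.single i 1 \<in> D"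
proof (rule ccontr)
  assume "\<not> ?thesis"
  then have "\<forall>A. \<exists>m. m \<in> D \<and> A \<le> Poly_Mapping.lookup m i \<and> m + Poly_Mapping.single i 1 \<notin> D"
    by blast
  then obtain f where f: "\<And>A. f A \<in> D" "\<And>A. A \<le> Poly_Mapping.lookup (f A) i"
    "\<And>A. f A + Poly_Mapping.single i 1 \<notin> D"
    by metis
  obtain r :: "nat \<Rightarrow> nat" where r: "strict_mono r"
      "\<And>j. mono (\<lambda>t. Poly_Mapping.lookup (f (r t)) j)"
    using dickson[of UNIV "\<lambda>t j. Poly_Mapping.lookup (f t) j"] by auto
  \<comment> \<open>The exponent of \<open>f (r t)\<close> at \<open>i\<close> is at least
    \<open>r t \<ge> t\<close>, hence exceeds that of \<open>f (r 0)\<close> and leaves room for one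
    more factor. Monotonicity handles the other exponents.\<close>
  define t where "t = Suc (Poly_Mapping.lookup (f (r 0)) i)"
  have "f (r 0) + Poly_Mapping.single i 1 \<in> D"
  proof (rule down[of "f (r t)"])
    show "Poly_Mapping.lookup (f (r 0) + Poly_Mapping.single i 1) j \<le> Poly_Mapping.lookup (f (r t)) j" for j
    proof (cases "j = i")
      case True
      have "t \<le> r t"
        using r(1) by (rule strict_mono_imp_increasing)
      also have "\<dots> \<le> Poly_Mapping.lookup (f (r t)) i"
        by (rule f(2))
      finally show ?thesis
        using True by (simp add: lookup_add t_def)
    next
      case False
      then show ?thesis
        using r(2)[of j] by (simp add: lookup_add lookup_single mono_def)
    qed
    show "Poly_Mapping.lookup (f (r 0) + Poly_Mapping.single i 1) j = c j" if "j \<notin> S" for j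
    proof -
      have "j \<noteq> i" using that \<open>i \<in> S\<close> by blast
      then show ?thesis
        using that f(1) const by (simp add: lookup_add lookup_single)
    qed
  qed (rule f(1))
  then show False
    using f(3) by blast
qed

text \<open>Multiplication by the variable \<open>i\<close> maps the elements of weight
  \<open>k\<close> with exponent at least \<open>A\<close> bijectively to those of weight
  \<open>k + w i\<close> with exponent at least \<open>Suc A\<close>. The remaining elements form
  finitely many slices \<open>F\<close>. The equation is additive to avoid truncated
  subtraction.\<close>

lemma card_shift_stable:
  fixes D :: "'n::finite monom set"
  assumes w: "\<And>i. w i > 0"
    and A: "\<And>m. m \<in> D \<Longrightarrow> A \<le> Poly_Mapping.lookup m i \<Longrightarrow> m + Poly_Mapping.single i 1 \<in> D"
    and down: "\<And>m. m + Poly_Mapping.single i 1 \<in> D \<Longrightarrow> m \<in> D"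
  defines "F \<equiv> \<lambda>k a. card {m \<in> D. Poly_Mapping.lookup m i = a \<and> weight w m = k}"
  shows "card {m \<in> D. weight w m = k + w i} + (\<Sum>a<A. F k a)
    = card {m \<in> D. weight w m = k} + (\<Sum>a<Suc A. F (k + w i) a)"
proof -
  define X where "X k = {m \<in> D. weight w m = k}" for k
  have fin: "finite (X k)" for k
    unfolding X_def using finite_weight_eq[of w k] w by simp
  have split: "card (X k) = (\<Sum>a<B. F k a) + card {m \<in> X k. B \<le> Poly_Mapping.lookup m i}" for k B
  proof -
    have "X k = {m \<in> X k. Poly_Mapping.lookup m i < B} \<union> {m \<in> X k. B \<le> Poly_Mapping.lookup m i}"
      by auto
    then have "card (X k) = card {m \<in> X k. Poly_Mapping.lookup m i < B} + card {m \<in> X k. B \<le> Poly_Mapping.lookup m i}"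
      using fin by (subst card_Un_disjoint[symmetric]) auto
    moreover have "card {m \<in> X k. Poly_Mapping.lookup m i = a} = F k a" for a
      unfolding F_def X_def by (rule arg_cong[where f = card]) auto
    ultimately show ?thesis
      using card_fibres_lessThan[OF fin] by simp
  qed
  let ?s = "\<lambda>m. m + Poly_Mapping.single i (1::nat)"
  have "{m \<in> X (k + w i). Suc A \<le> Poly_Mapping.lookup m i} = ?s ` {m \<in> X k. A \<le> Poly_Mapping.lookup m i}"
  proof (intro equalityI subsetI)
    fix m assume m: "m \<in> {m \<in> X (k + w i). Suc A \<le> Poly_Mapping.lookup m i}"
    \<comment> \<open>Division by the variable \<open>i\<close> is exact, since the exponent is at
      least \<open>Suc A\<close>.\<close>
    define m' where "m' = m - Poly_Mapping.single i 1"
    have eq: "m = ?s m'"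
      using m by (intro poly_mapping_eqI)
        (auto simp: m'_def lookup_add lookup_minus lookup_single when_def)
    moreover have "m' \<in> X k" "A \<le> Poly_Mapping.lookup m' i"
      using m down[of m'] unfolding eq X_def by (auto simp: weight_add weight_single lookup_add)
    ultimately show "m \<in> ?s ` {m \<in> X k. A \<le> Poly_Mapping.lookup m i}" by blast
  next
    fix m assume "m \<in> ?s ` {m \<in> X k. A \<le> Poly_Mapping.lookup m i}"
    then show "m \<in> {m \<in> X (k + w i). Suc A \<le> Poly_Mapping.lookup m i}"
      using A by (auto simp: X_def weight_add weight_single lookup_add)
  qed
  moreover have "card (?s ` {m \<in> X k. A \<le> Poly_Mapping.lookup m i}) = card {m \<in> X k. A \<le> Poly_Mapping.lookup m i}"
    by (rule card_image) (simp add: inj_on_def)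
  ultimately show ?thesis
    using split[of "k + w i" "Suc A"] split[of k A] by (simp add: X_def)
qed

text \<open>
  The exponents outside \<open>S\<close> are prescribed by \<open>c\<close>, so that the slices of \<open>D\<close> with a fixed exponent
  of one variable in \<open>S\<close> are of the same kind.
\<close>
lemma count_eventually_quasi_poly_aux:
  fixes D :: "'n::finite monom set"
  assumes "finite S" and w: "\<And>i. w i > 0" and d: "d > 0" "\<And>i. w i dvd d"
    and const: "\<And>m j. m \<in> D \<Longrightarrow> j \<notin> S \<Longrightarrow> Poly_Mapping.lookup m j = c j"
    and down: "\<And>m m'. m \<in> D \<Longrightarrow> (\<And>j. j \<in> S \<Longrightarrow> Poly_Mapping.lookup m' j \<le> Poly_Mapping.lookup m j) \<Longrightarrow>
      (\<And>j. j \<notin> S \<Longrightarrow> Poly_Mapping.lookup m' j = c j) \<Longrightarrow> m' \<in> D"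
  shows "eventually_quasi_poly d (\<lambda>k. of_nat (card {m \<in> D. weight w m = k}))"
  using \<open>finite S\<close> const down
proof (induction S arbitrary: D c)
  case empty
  have "\<forall>\<^sub>F k in sequentially. 0 = (of_nat (card {m \<in> D. weight w m = k}) :: rat)"
  proof (cases "D = {}")
    case False
    then obtain m0 where "m0 \<in> D" by blast
    \<comment> \<open>With no free exponents \<open>c\<close> determines the monomial, so
      \<open>D\<close> has at most one element and the count vanishes beyond its weight.\<close>
    have "m = m0" if "m \<in> D" for m
      using empty(1)[OF that] empty(1)[OF \<open>m0 \<in> D\<close>] by (intro poly_mapping_eqI) simp
    then have "card {m \<in> D. weight w m = k} = 0" if "k > weight w m0" for k
      using that by (auto simp: card_eq_0_iff)
    then show ?thesis
      unfolding eventually_sequentially by (intro exI[of _ "Suc (weight w m0)"]) simp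
  qed simp
  with eventually_quasi_poly_zero show ?case
    by (rule eventually_quasi_poly_cong)
next
  case (insert i S)
  define F where "F k a = card {m \<in> D. Poly_Mapping.lookup m i = a \<and> weight w m = k}" for k a
  have F: "eventually_quasi_poly d (\<lambda>k. of_nat (F k a))" for a
  proof -
    have "eventually_quasi_poly d
        (\<lambda>k. of_nat (card {m \<in> {m \<in> D. Poly_Mapping.lookup m i = a}. weight w m = k}))"
    \<comment> \<open>Within a slice the exponent of \<open>i\<close> is prescribed as well, which
      removes \<open>i\<close> from the free variables.\<close>
    proof (rule insert.IH[where c = "c(i := a)"])
      fix m j assume "m \<in> {m \<in> D. Poly_Mapping.lookup m i = a}" "j \<notin> S"
      then show "Poly_Mapping.lookup m j = (c(i := a)) j"
        using insert.prems(1) by auto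
    next
      fix m m'
      assume m: "m \<in> {m \<in> D. Poly_Mapping.lookup m i = a}" "\<And>j. j \<in> S \<Longrightarrow> Poly_Mapping.lookup m' j \<le> Poly_Mapping.lookup m j"
        "\<And>j. j \<notin> S \<Longrightarrow> Poly_Mapping.lookup m' j = (c(i := a)) j"
      have "Poly_Mapping.lookup m' i = a"
        using m(3)[of i] insert.hyps by simp
      moreover have "m' \<in> D"
      proof (rule insert.prems(2)[of m])
        show "Poly_Mapping.lookup m' j \<le> Poly_Mapping.lookup m j" if "j \<in> insert i S" for j
          using that m(1,2) \<open>Poly_Mapping.lookup m' i = a\<close> by auto
        show "Poly_Mapping.lookup m' j = c j" if "j \<notin> insert i S" for j
          using that m(3)[of j] by simp
      qed (use m(1) in simp)
      ultimately show "m' \<in> {m \<in> D. Poly_Mapping.lookup m i = a}" by simp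
    qed
    then show ?thesis by (simp add: F_def conj_assoc)
  qed
  obtain A where A: "\<And>m. m \<in> D \<Longrightarrow> A \<le> Poly_Mapping.lookup m i \<Longrightarrow> m + Poly_Mapping.single i 1 \<in> D"
    using down_closed_shift_stable[of D "insert i S" c i] insert.prems by blast
  have down1: "m \<in> D" if "m + Poly_Mapping.single i 1 \<in> D" for m
  proof (rule insert.prems(2)[OF that])
    show "Poly_Mapping.lookup m j = c j" if "j \<notin> insert i S" for j
      using insert.prems(1)[OF \<open>m + Poly_Mapping.single i 1 \<in> D\<close> that] that
      by (auto simp: lookup_add lookup_single when_def split: if_splits)
  qed (simp add: lookup_add)
  show ?case
  \<comment> \<open>The difference of the counts at \<open>k + w i\<close> and \<open>k\<close> is a
    combination of finitely many slice counts, which are quasi-polynomial by induction.\<close>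
  proof (rule eventually_quasi_poly_antidifference[OF d(1) d(2)[of i]])
    show "of_nat (card {m \<in> D. weight w m = k + w i}) =
        of_nat (card {m \<in> D. weight w m = k})
        + ((\<Sum>a<Suc A. of_nat (F (k + w i) a)) + - (\<Sum>a<A. of_nat (F k a)) :: rat)" for k
      using arg_cong[OF card_shift_stable[of w D A i k, OF w A down1], of "of_nat :: nat \<Rightarrow> rat"]
      unfolding F_def[symmetric] by (simp add: algebra_simps)
    show "eventually_quasi_poly d
        (\<lambda>k. (\<Sum>a<Suc A. of_nat (F (k + w i) a)) + - (\<Sum>a<A. of_nat (F k a)))"
      by (intro eventually_quasi_poly_add eventually_quasi_poly_uminus eventually_quasi_poly_sum F
          eventually_quasi_poly_shift[where f = "\<lambda>k. of_nat (F k _)"])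
  qed
qed

lemma count_eventually_quasi_poly:
  fixes D :: "'n::finite monom set"
  assumes "\<And>i. w i > 0" and "d > 0" "\<And>i. w i dvd d"
    and down: "\<And>a b. a + b \<in> D \<Longrightarrow> a \<in> D"
  shows "eventually_quasi_poly d (\<lambda>k. of_nat (card {m \<in> D. weight w m = k}))"
proof (rule count_eventually_quasi_poly_aux[of UNIV])
  fix m m' assume "m \<in> D" "\<And>j. j \<in> UNIV \<Longrightarrow> Poly_Mapping.lookup m' j \<le> Poly_Mapping.lookup m j"
  \<comment> \<open>Exponentwise comparison is divisibility: the cofactor is \<open>m - m'\<close>.
    Here \<open>S\<close> is all of \<open>UNIV\<close>, so no exponent is prescribed.\<close>
  moreover from this have "m = m' + (m - m')"
    by (intro poly_mapping_eqI) (simp add: lookup_add lookup_minus)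
  ultimately show "m' \<in> D"
    using down[of m' "m - m'"] by simp
qed (use assms in auto)

section \<open>Initial ideals\<close>

lemma poly_mapping_sum_single:
  "f = (\<Sum>m\<in>Poly_Mapping.keys f. Poly_Mapping.single m (Poly_Mapping.lookup f m))"
proof (rule poly_mapping_eqI)
  fix k
  have "(\<Sum>m\<in>Poly_Mapping.keys f. Poly_Mapping.lookup (Poly_Mapping.single m (Poly_Mapping.lookup f m)) k)
      = (\<Sum>m\<in>Poly_Mapping.keys f. if m = k then Poly_Mapping.lookup f k else 0)"
    by (intro sum.cong) (auto simp: lookup_single when_def)
  then show "Poly_Mapping.lookup f k
      = Poly_Mapping.lookup (\<Sum>m\<in>Poly_Mapping.keys f. Poly_Mapping.single m (Poly_Mapping.lookup f m)) k"
    by (simp add: lookup_sum in_keys_iff)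
qed

lemma lookup_single_mult:
  fixes f :: "('n, 'k::field) mpoly"
  shows "Poly_Mapping.lookup (Poly_Mapping.single a c * f) (a + m) = c * Poly_Mapping.lookup f m"
  by (simp add: lookup_mult lookup_single when_mult)

lemma keys_single_mult:
  fixes f :: "('n, 'k::field) mpoly"
  assumes "c \<noteq> 0"
  shows "Poly_Mapping.keys (Poly_Mapping.single a c * f) = (+) a ` Poly_Mapping.keys f"
proof
  show "Poly_Mapping.keys (Poly_Mapping.single a c * f) \<subseteq> (+) a ` Poly_Mapping.keys f"
    using keys_mult[of "Poly_Mapping.single a c" f] assms by auto
  show "(+) a ` Poly_Mapping.keys f \<subseteq> Poly_Mapping.keys (Poly_Mapping.single a c * f)"
    using assms by (auto simp: in_keys_iff lookup_single_mult)
qed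

section \<open>Leading monomials\<close>

text \<open>Two distinct candidates would each precede the other, contradicting transitivity and
  irreflexivity; so the description in \<open>leading_monomial\<close> has a unique witness.\<close>

lemma leading_monomial_eqI:
  assumes "irreflp prec" "transp prec"
    and "m \<in> Poly_Mapping.keys f" "\<And>m'. m' \<in> Poly_Mapping.keys f \<Longrightarrow> m' \<noteq> m \<Longrightarrow> prec m' m"
  shows "leading_monomial prec f = m"
  unfolding leading_monomial_def
proof (rule the_equality)
  fix m' assume "m' \<in> Poly_Mapping.keys f \<and> (\<forall>m''\<in>Poly_Mapping.keys f. m'' \<noteq> m' \<longrightarrow> prec m'' m')"
  then show "m' = m"
    using assms by (metis irreflpD transpD)
qed (use assms in blast)

text \<open>The support is finite and nonempty, so it has a maximal element, and totality makes it
  the greatest.\<close>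

lemma leading_monomial:
  assumes ord: "irreflp prec" "transp prec" "totalp prec" and "f \<noteq> 0"
  shows "leading_monomial prec f \<in> Poly_Mapping.keys f"
    and "m \<in> Poly_Mapping.keys f \<Longrightarrow> m \<noteq> leading_monomial prec f \<Longrightarrow> prec m (leading_monomial prec f)"
proof -
  have "asymp prec"
    using ord(1,2) by (simp add: asymp_on_iff_irreflp_on_if_transp_on)
  then have "\<exists>m\<in>Poly_Mapping.keys f. \<forall>m'\<in>Poly_Mapping.keys f. m' \<noteq> m \<longrightarrow> \<not> prec m m'"
    using ord(2) \<open>f \<noteq> 0\<close>
    by (intro Finite_Set.bex_max_element)
      (auto intro: asymp_on_subset[OF _ subset_UNIV] transp_on_subset[OF _ subset_UNIV])
  then obtain l where l: "l \<in> Poly_Mapping.keys f" "\<And>m'. m' \<in> Poly_Mapping.keys f \<Longrightarrow> m' \<noteq> l \<Longrightarrow> prec m' l"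
    using ord(3) by (metis totalpD)
  then have "leading_monomial prec f = l"
    using ord by (intro leading_monomial_eqI)
  with l show "leading_monomial prec f \<in> Poly_Mapping.keys f"
    "m \<in> Poly_Mapping.keys f \<Longrightarrow> m \<noteq> leading_monomial prec f \<Longrightarrow> prec m (leading_monomial prec f)"
    by auto
qed

text \<open>The support of the product is the translate of the support of \<open>f\<close> by
  \<open>a\<close>, and translation preserves the ordering.\<close>

lemma leading_monomial_single_mult:
  fixes f :: "('n::finite, 'k::field) mpoly"
  assumes ord: "irreflp prec" "transp prec" "totalp prec"
    and mono: "\<And>a b c. prec a b \<Longrightarrow> prec (c + a) (c + b)" and "f \<noteq> 0" "c \<noteq> 0"
  shows "leading_monomial prec (Poly_Mapping.single a c * f) = a + leading_monomial prec f"
  using ord(1,2)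
proof (rule leading_monomial_eqI)
  show "a + leading_monomial prec f \<in> Poly_Mapping.keys (Poly_Mapping.single a c * f)"
    using leading_monomial(1)[OF ord \<open>f \<noteq> 0\<close>] \<open>c \<noteq> 0\<close> by (simp add: keys_single_mult)
  fix m assume "m \<in> Poly_Mapping.keys (Poly_Mapping.single a c * f)" "m \<noteq> a + leading_monomial prec f"
  then show "prec m (a + leading_monomial prec f)"
    using leading_monomial(2)[OF ord \<open>f \<noteq> 0\<close>] \<open>c \<noteq> 0\<close> mono by (auto simp: keys_single_mult)
qed

lemma strict_order_weighted_ordering:
  assumes "monomial_ordering prec"
  shows "irreflp (weighted_ordering w prec)" "transp (weighted_ordering w prec)"
    "totalp (weighted_ordering w prec)"
    "weighted_ordering w prec a b \<Longrightarrow> weighted_ordering w prec (c + a) (c + b)"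
proof -
  note prec = assms[unfolded monomial_ordering_def]
  show "irreflp (weighted_ordering w prec)"
    using prec by (auto simp: irreflp_def weighted_ordering_def)
  show "transp (weighted_ordering w prec)"
    using prec unfolding weighted_ordering_def
    by (intro transpI) (metis less_trans transpD)
  show "totalp (weighted_ordering w prec)"
    using prec unfolding weighted_ordering_def
    by (intro totalpI) (metis linorder_neqE_nat totalpD)
  show "weighted_ordering w prec (c + a) (c + b)" if "weighted_ordering w prec a b"
    using that prec
    by (auto simp: weighted_ordering_def weight_add add.commute[of c])
qed

section \<open>Monomial ideals described by their supports\<close>

text \<open>This is the linear span of the monomials in \<open>M\<close>. Describing it by supports
  serves both uses: an ideal when \<open>M\<close> is closed under multiples, and a coordinate
  subspace for arbitrary \<open>M\<close>.\<close>

definition supported :: "'n monom set \<Rightarrow> ('n::finite, 'k::field) mpoly set" where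
  "supported M = {f. Poly_Mapping.keys f \<subseteq> M}"

lemma supported_closed:
  shows zero_supported: "0 \<in> supported M"
    and add_supported: "f \<in> supported M \<Longrightarrow> g \<in> supported M \<Longrightarrow> f + g \<in> supported M"
    and uminus_supported: "f \<in> supported M \<Longrightarrow> - f \<in> supported M"
    and scale_supported: "f \<in> supported M \<Longrightarrow> Poly_Mapping.single 0 c * f \<in> supported M"
proof -
  show "0 \<in> supported M" by (simp add: supported_def)
  show "f + g \<in> supported M" if "f \<in> supported M" "g \<in> supported M"
    using that keys_add[of f g] by (auto simp: supported_def)
  show "- f \<in> supported M" if "f \<in> supported M"
    using that by (simp add: supported_def in_keys_iff subset_iff)
  show "Poly_Mapping.single 0 c * f \<in> supported M" if "f \<in> supported M"
    using that by (cases "c = 0") (auto simp: supported_def keys_single_mult)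
qed

text \<open>Every monomial of a product \<open>g * f\<close> is a multiple of some monomial of
  \<open>f\<close>, hence stays in \<open>U\<close>.\<close>

lemma ideal_supported:
  assumes "\<And>a m. m \<in> U \<Longrightarrow> a + m \<in> U"
  shows "ideal (supported U :: ('n::finite, 'k::field) mpoly set) mpoly_ring"
proof (rule idealI)
  show "ring (mpoly_ring :: ('n, 'k) mpoly ring)"
    by (rule class_ring.ring_axioms)
  show "subgroup (supported U) (add_monoid (mpoly_ring :: ('n, 'k) mpoly ring))"
  proof (rule subgroup.intro)
    fix f :: "('n, 'k) mpoly" assume "f \<in> supported U"
    moreover have "inv\<^bsub>add_monoid mpoly_ring\<^esub> f = - f"
      unfolding a_inv_def[symmetric] by (simp add: class_ring_simps)
    ultimately show "inv\<^bsub>add_monoid mpoly_ring\<^esub> f \<in> supported U"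
      by (simp only: uminus_supported)
  qed (auto simp: supported_closed)
  have mult: "g * f \<in> supported U" if "f \<in> supported U" for f g :: "('n, 'k) mpoly"
    using that keys_mult[of g f] assms by (force simp: supported_def)
  show "x \<otimes>\<^bsub>mpoly_ring\<^esub> a \<in> supported U" "a \<otimes>\<^bsub>mpoly_ring\<^esub> x \<in> supported U"
    if "a \<in> supported U" for a x :: "('n, 'k) mpoly"
    using mult[OF that, of x] by (simp_all add: mult.commute)
qed

lemma
  fixes J :: "('n::finite, 'k::field) mpoly set"
  assumes "ideal J mpoly_ring"
  shows ideal_zero: "0 \<in> J"
    and ideal_add: "f \<in> J \<Longrightarrow> g \<in> J \<Longrightarrow> f + g \<in> J"
    and ideal_mult: "f \<in> J \<Longrightarrow> g * f \<in> J"
proof -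
  interpret ideal J "mpoly_ring :: ('n, 'k) mpoly ring" by fact
  show "0 \<in> J" "f \<in> J \<Longrightarrow> g \<in> J \<Longrightarrow> f + g \<in> J" "f \<in> J \<Longrightarrow> g * f \<in> J"
    using additive_subgroup.zero_closed[OF additive_subgroup_axioms] a_closed I_l_closed by auto
qed

text \<open>Multiplying a polynomial of \<open>I\<close> by a monomial shows that leading monomials
  are closed under multiples, so the supported polynomials form an ideal containing the generators.
  Conversely, each monomial outside the staircase is a scalar multiple of a leading term, and
  polynomials are sums of their terms.\<close>

lemma initial_ideal_eq_supported:
  fixes I :: "('n::finite, 'k::field) mpoly set"
  assumes ord: "irreflp prec" "transp prec" "totalp prec"
    and mono: "\<And>a b c. prec a b \<Longrightarrow> prec (c + a) (c + b)"
    and I: "ideal I mpoly_ring"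
  shows "initial_ideal prec I = supported (- staircase prec I)"
    and "\<And>a m. m \<in> - staircase prec I \<Longrightarrow> a + m \<in> - staircase prec I"
proof -
  let ?U = "- staircase prec I"
  let ?S = "{leading_term prec f |f. f \<in> I \<and> f \<noteq> 0}"
  show up: "a + m \<in> ?U" if m: "m \<in> ?U" for a m
  proof -
    obtain f where f: "f \<in> I" "f \<noteq> 0" "leading_monomial prec f = m"
      using m by (auto simp: staircase_def)
    let ?g = "Poly_Mapping.single a 1 * f"
    have "?g \<in> I"
      using I f(1) by (rule ideal_mult)
    moreover have "Poly_Mapping.keys ?g \<noteq> {}"
      using f(2) by (simp add: keys_single_mult)
    then have "?g \<noteq> 0" by auto
    moreover have "leading_monomial prec ?g = a + m"
      using leading_monomial_single_mult[OF ord mono f(2), of 1 a] f(3) by simp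
    ultimately show ?thesis by (auto simp: staircase_def)
  qed
  show "initial_ideal prec I = supported ?U"
  proof
    show "initial_ideal prec I \<subseteq> supported ?U"
      unfolding initial_ideal_def
    proof (rule ring.genideal_minimal[OF class_ring.ring_axioms])
      show "ideal (supported ?U) (mpoly_ring :: ('n, 'k) mpoly ring)"
        using up by (rule ideal_supported)
      show "?S \<subseteq> supported ?U"
        by (auto simp: supported_def leading_term_def staircase_def split: if_splits)
    qed
    have J: "ideal (initial_ideal prec I) mpoly_ring"
      unfolding initial_ideal_def by (rule ring.genideal_ideal[OF class_ring.ring_axioms]) simp
    have S: "?S \<subseteq> initial_ideal prec I"
      unfolding initial_ideal_def by (rule ring.genideal_self[OF class_ring.ring_axioms]) simp
    show "supported ?U \<subseteq> initial_ideal prec I"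
    proof
      fix f :: "('n, 'k) mpoly" assume f: "f \<in> supported ?U"
      have "Poly_Mapping.single m c \<in> initial_ideal prec I" if m: "m \<in> ?U" for m c
      proof -
        obtain g where g: "g \<in> I" "g \<noteq> 0" "leading_monomial prec g = m"
          using m by (auto simp: staircase_def)
        then have "Poly_Mapping.lookup g m \<noteq> 0"
          using leading_monomial(1)[OF ord g(2)] by (simp add: in_keys_iff)
        \<comment> \<open>The leading coefficient of \<open>g\<close> is invertible, so rescaling
          produces any coefficient \<open>c\<close>.\<close>
        then have "Poly_Mapping.single m c
            = Poly_Mapping.single 0 (c / Poly_Mapping.lookup g m) * leading_term prec g"
          using g(3) by (simp add: leading_term_def mult_single)
        then show ?thesis
          using ideal_mult[OF J] S g by auto
      qed
      then have "(\<Sum>m\<in>F. Poly_Mapping.single m (Poly_Mapping.lookup f m)) \<in> initial_ideal prec I"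
        if "F \<subseteq> ?U" for F
        using that
        by (induction F rule: infinite_finite_induct)
          (auto intro: ideal_zero[OF J] ideal_add[OF J])
      from this[of "Poly_Mapping.keys f"] show "f \<in> initial_ideal prec I"
        using f poly_mapping_sum_single[of f] by (simp add: supported_def)
    qed
  qed
qed

section \<open>The Hilbert function of a monomial ideal\<close>

lemma mpoly_space_simps:
  "carrier mpoly_space = UNIV" "\<zero>\<^bsub>mpoly_space\<^esub> = 0" "f \<oplus>\<^bsub>mpoly_space\<^esub> g = f + g"
  "c \<odot>\<^bsub>mpoly_space\<^esub> f = Poly_Mapping.single 0 c * f"
  by (simp_all add: mpoly_space_def)

lemma vectorspace_mpoly_space:
  "vectorspace class_ring (mpoly_space :: ('k::field, ('n::finite, 'k) mpoly) module)"
proof (rule vectorspace.intro[OF moduleI])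
  show "cring (class_ring :: 'k ring)" by (rule class_cring.cring_axioms)
  show "field (class_ring :: 'k ring)" by (rule class_field)
  show "abelian_group (mpoly_space :: ('k, ('n, 'k) mpoly) module)"
    by (rule abelian_groupI) (auto simp: mpoly_space_simps add_ac intro: exI[of _ "- _"])
qed (auto simp: mpoly_space_simps algebra_simps single_add mult_single mult.assoc[symmetric])

lemma subspace_supported:
  "submodule class_ring (supported M) (mpoly_space :: ('k::field, ('n::finite, 'k) mpoly) module)"
proof (rule submodule.intro)
  show "module class_ring (mpoly_space :: ('k, ('n, 'k) mpoly) module)"
    using vectorspace_mpoly_space by (rule vectorspace.axioms)
qed (auto simp: mpoly_space_simps supported_closed)

lemma span_monomials:
  "LinearCombinations.module.span (class_ring :: 'k::field ring) mpoly_space ((\<lambda>m. Poly_Mapping.single m 1) ` M)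
    = (supported M :: ('n::finite, 'k) mpoly set)"
proof
  let ?X = "(\<lambda>m. Poly_Mapping.single m 1) ` M :: ('n, 'k) mpoly set"
  interpret V: vectorspace "class_ring :: 'k ring" "mpoly_space :: ('k, ('n, 'k) mpoly) module"
    by (rule vectorspace_mpoly_space)
  show "V.span ?X \<subseteq> supported M"
    by (rule V.span_is_subset[OF _ subspace_supported]) (auto simp: supported_def)
  have X: "?X \<subseteq> carrier mpoly_space"
    by (simp add: mpoly_space_simps)
  interpret X: submodule "class_ring :: 'k ring" "V.span ?X" "mpoly_space :: ('k, ('n, 'k) mpoly) module"
    using X by (rule V.span_is_submodule)
  show "supported M \<subseteq> V.span ?X"
  proof
    fix f :: "('n, 'k) mpoly" assume f: "f \<in> supported M"
    have mem: "Poly_Mapping.single m c \<in> V.span ?X" if "m \<in> M" for m c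
      using X.smult_closed[of c "Poly_Mapping.single m 1"] V.in_own_span[OF X] that
      by (auto simp: mpoly_space_simps mult_single)
    have "(\<Sum>m\<in>F. Poly_Mapping.single m (Poly_Mapping.lookup f m)) \<in> V.span ?X" if "F \<subseteq> M" for F
      using that
    proof (induction F rule: infinite_finite_induct)
      case (insert m F)
      then show ?case
        using X.m_closed[of "Poly_Mapping.single m (Poly_Mapping.lookup f m)"] mem
        by (simp add: mpoly_space_simps)
    qed (use X.zero_closed in \<open>simp_all add: mpoly_space_simps\<close>)
    from this[of "Poly_Mapping.keys f"] show "f \<in> V.span ?X"
      using f poly_mapping_sum_single[of f] by (simp add: supported_def)
  qed
qed

lemma single_one_eq_iff:
  "Poly_Mapping.single m (1::'k::zero_neq_one) = Poly_Mapping.single m' 1 \<longleftrightarrow> m = m'"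
proof
  assume "Poly_Mapping.single m (1::'k) = Poly_Mapping.single m' 1"
  then have "Poly_Mapping.keys (Poly_Mapping.single m (1::'k)) = Poly_Mapping.keys (Poly_Mapping.single m' (1::'k))"
    by simp
  then show "m = m'" by simp
qed simp

text \<open>The monomials in \<open>M\<close> form a basis. Independence is checked in the whole
  polynomial space by comparing coefficients, then transferred, together with the span, to the
  subspace \<open>V\<close>.\<close>

lemma dim_supported:
  fixes M :: "'n::finite monom set"
  defines "V \<equiv> (mpoly_space :: ('k::field, ('n, 'k) mpoly) module)\<lparr>carrier := supported M\<rparr>"
  assumes "finite M"
  shows "vectorspace class_ring V" "vectorspace.fin_dim class_ring V"
    "vectorspace.dim class_ring V = card M"
proof -
  interpret P: vectorspace "class_ring :: 'k ring" "mpoly_space :: ('k, ('n, 'k) mpoly) module"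
    by (rule vectorspace_mpoly_space)
  show V: "vectorspace class_ring V"
    unfolding V_def
    by (intro P.subspace_is_vs subspace.intro vectorspace_mpoly_space subspace_supported)
  interpret V: vectorspace "class_ring :: 'k ring" V by (rule V)
  let ?X = "(\<lambda>m. Poly_Mapping.single m 1) ` M :: ('n, 'k) mpoly set"
  have inj: "inj_on (\<lambda>m. Poly_Mapping.single m (1::'k)) M"
    by (simp add: inj_on_def single_one_eq_iff)
  have X: "?X \<subseteq> supported M"
    by (auto simp: supported_def)
  have lincomb: "P.lincomb a ?X = (\<Sum>m\<in>M. Poly_Mapping.single m (a (Poly_Mapping.single m 1)))" for a
  proof -
    have fs: "finsum mpoly_space g A = sum g A" if "finite A"
      for g :: "('n, 'k) mpoly \<Rightarrow> ('n, 'k) mpoly" and A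
      using that
      by (induction A) (simp_all add: P.M.finsum_insert mpoly_space_simps)
    have "P.lincomb a ?X = (\<Sum>v\<in>?X. Poly_Mapping.single 0 (a v) * v)"
      using fs \<open>finite M\<close> by (simp add: P.lincomb_def mpoly_space_simps)
    also have "\<dots> = (\<Sum>m\<in>M. Poly_Mapping.single m (a (Poly_Mapping.single m 1)))"
      by (simp add: sum.reindex[OF inj] mult_single)
    finally show ?thesis .
  qed
  have "P.lin_indpt ?X"
  proof (rule P.finite_lin_indpt2)
    fix a assume "P.lincomb a ?X = \<zero>\<^bsub>mpoly_space\<^esub>"
    then have *: "(\<Sum>m\<in>M. Poly_Mapping.single m (a (Poly_Mapping.single m 1))) = 0"
      by (simp add: lincomb mpoly_space_simps)
    have "a (Poly_Mapping.single m 1) = 0" if "m \<in> M" for m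
    proof -
      have "0 = (\<Sum>m'\<in>M. Poly_Mapping.lookup
          (Poly_Mapping.single m' (a (Poly_Mapping.single m' 1))) m)"
        using arg_cong[OF *, of "\<lambda>f. Poly_Mapping.lookup f m"] by (simp add: lookup_sum)
      also have "\<dots> = (\<Sum>m'\<in>M. if m' = m then a (Poly_Mapping.single m 1) else 0)"
        by (intro sum.cong) (auto simp: lookup_single when_def)
      also have "\<dots> = a (Poly_Mapping.single m 1)"
        using that \<open>finite M\<close> by simp
      finally show ?thesis by simp
    qed
    then show "\<forall>v\<in>?X. a v = \<zero>\<^bsub>class_ring\<^esub>" by simp
  qed (use \<open>finite M\<close> in \<open>simp_all add: mpoly_space_simps\<close>)
  then have "V.lin_indpt ?X"
    unfolding V_def using P.span_li_not_depend(2)[OF X subspace_supported] by simp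
  moreover have gen: "V.span ?X = carrier V"
    unfolding V_def using P.span_li_not_depend(1)[OF X subspace_supported]
    by (simp add: span_monomials)
  moreover have carr: "?X \<subseteq> carrier V"
    using X by (simp add: V_def)
  ultimately have "V.basis ?X"
    by (simp add: V.basis_def)
  then show "V.dim = card M"
    using V.dim_basis[of ?X] \<open>finite M\<close> by (simp add: card_image[OF inj])
  show "V.fin_dim"
    unfolding V.fin_dim_def using \<open>finite M\<close> gen carr by blast
qed

section \<open>The graded parts of the quotient\<close>

text \<open>The projection to the quotient is a ring homomorphism, so the operations of
  \<open>quotient_space\<close> can be computed on representatives.\<close>

lemma
  fixes J :: "('n::finite, 'k::field) mpoly set"
  assumes J: "ideal J mpoly_ring"
  defines "T \<equiv> \<lambda>f. J +>\<^bsub>mpoly_ring\<^esub> f"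
  shows carrier_quotient_space: "carrier (quotient_space J) = range T"
    and zero_quotient_space: "\<zero>\<^bsub>quotient_space J\<^esub> = T 0"
    and add_quotient_space: "T f \<oplus>\<^bsub>quotient_space J\<^esub> T g = T (f + g)"
    and smult_quotient_space: "c \<odot>\<^bsub>quotient_space J\<^esub> T f = T (Poly_Mapping.single 0 c * f)"
    and coset_eq_iff: "T f = T g \<longleftrightarrow> f - g \<in> J"
proof -
  interpret ideal J "mpoly_ring :: ('n, 'k) mpoly ring" by fact
  have hom: "T \<in> Ring.ring_hom mpoly_ring (mpoly_ring Quot J)"
    unfolding T_def by (rule rcos_ring_hom)
  show "carrier (quotient_space J) = range T"
    by (auto simp: quotient_space_def Let_def FactRing_def A_RCOSETS_def' T_def)
  show "T f \<oplus>\<^bsub>quotient_space J\<^esub> T g = T (f + g)"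
    using ring_hom_add[OF hom, of f g] by (simp add: quotient_space_def Let_def)
  show "c \<odot>\<^bsub>quotient_space J\<^esub> T f = T (Poly_Mapping.single 0 c * f)"
    using ring_hom_mult[OF hom, of "Poly_Mapping.single 0 c" f]
    by (simp add: quotient_space_def Let_def T_def)
  show "\<zero>\<^bsub>quotient_space J\<^esub> = T 0"
    using ring_hom_zero[OF hom class_ring.ring_axioms quotient_is_ring]
    by (simp add: quotient_space_def Let_def)
  show "T f = T g \<longleftrightarrow> f - g \<in> J"
    using ring.quotient_eq_iff_same_a_r_cos[OF class_ring.ring_axioms J, of f g] by (simp add: T_def class_ring_simps)
qed

lemma vectorspace_quotient_space:
  fixes J :: "('n::finite, 'k::field) mpoly set"
  assumes J: "ideal J mpoly_ring"
  shows "vectorspace class_ring (quotient_space J)"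
proof (rule vectorspace.intro[OF moduleI])
  note quot = carrier_quotient_space[OF J] zero_quotient_space[OF J] add_quotient_space[OF J]
    smult_quotient_space[OF J]
  show "cring (class_ring :: 'k ring)" by (rule class_cring.cring_axioms)
  show "field (class_ring :: 'k ring)" by (rule class_field)
  show "abelian_group (quotient_space J)"
  proof (rule abelian_groupI)
    fix x assume "x \<in> carrier (quotient_space J)"
    then obtain f where f: "x = J +>\<^bsub>mpoly_ring\<^esub> f" by (auto simp: quot)
    show "\<exists>y\<in>carrier (quotient_space J). y \<oplus>\<^bsub>quotient_space J\<^esub> x = \<zero>\<^bsub>quotient_space J\<^esub>"
      by (rule bexI[of _ "J +>\<^bsub>mpoly_ring\<^esub> (- f)"]) (auto simp: quot f)
  qed (auto simp: quot add_ac)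
qed (auto simp: carrier_quotient_space[OF J] add_quotient_space[OF J] smult_quotient_space[OF J]
    algebra_simps single_add mult_single mult.assoc[symmetric])

text \<open>The projection restricts to a linear isomorphism from the span of the monomials of
  weight \<open>k\<close> outside \<open>U\<close> onto \<open>quotient_part w J k\<close>, so the
  two dimensions agree.\<close>

lemma hilbert_function_supported:
  fixes J :: "('n::finite, 'k::field) mpoly set"
  assumes J: "ideal J mpoly_ring" "J = supported U" and fin: "finite {m. weight w m = k}"
  shows "hilbert_function w J k = card {m. m \<notin> U \<and> weight w m = k}"
proof -
  let ?T = "\<lambda>f. J +>\<^bsub>mpoly_ring\<^esub> f"
  let ?M = "{m. weight w m = k}" and ?B = "{m. m \<notin> U \<and> weight w m = k}"
  let ?V = "(mpoly_space :: ('k, ('n, 'k) mpoly) module)\<lparr>carrier := supported ?B\<rparr>"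
  let ?W = "quotient_space J\<lparr>carrier := quotient_part w J k\<rparr>"
  have finB: "finite ?B"
    by (rule finite_subset[OF _ fin]) auto
  have "?T ` supported ?M \<subseteq> ?T ` supported ?B"
  proof
    fix x assume "x \<in> ?T ` supported ?M"
    then obtain f where f: "f \<in> supported ?M" "x = ?T f" by blast
    \<comment> \<open>\<open>g\<close> is \<open>f\<close> without its terms in \<open>U\<close>;
      the dropped terms lie in \<open>J\<close>, so the coset is unchanged.\<close>
    define g where "g = (\<Sum>m\<in>Poly_Mapping.keys f \<inter> ?B. Poly_Mapping.single m (Poly_Mapping.lookup f m))"
    have g: "Poly_Mapping.lookup g m = (if m \<in> ?B then Poly_Mapping.lookup f m else 0)" for m
    proof -
      have "Poly_Mapping.lookup g m
          = (\<Sum>m'\<in>Poly_Mapping.keys f \<inter> ?B. if m' = m then Poly_Mapping.lookup f m else 0)"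
        unfolding g_def lookup_sum by (intro sum.cong) (auto simp: lookup_single when_def)
      then show ?thesis
        by (simp add: in_keys_iff)
    qed
    have "f - g \<in> J"
      using f(1) by (auto simp: J(2) supported_def in_keys_iff lookup_minus g split: if_splits)
    then have "x = ?T g"
      using coset_eq_iff[OF J(1)] f(2) by blast
    moreover have "g \<in> supported ?B"
      by (auto simp: supported_def in_keys_iff g split: if_splits)
    ultimately show "x \<in> ?T ` supported ?B" by blast
  qed
  moreover have "?T ` supported ?B \<subseteq> ?T ` supported ?M"
    by (rule image_mono) (auto simp: supported_def)
  moreover have "{Poly_Mapping.single m (1::'k) |m. weight w m = k} = (\<lambda>m. Poly_Mapping.single m 1) ` ?M"
    by auto
  ultimately have part: "quotient_part w J k = ?T ` supported ?B"
    unfolding quotient_part_def by (simp only: span_monomials)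
  interpret Q: vectorspace "class_ring :: 'k ring" "quotient_space J"
    using J(1) by (rule vectorspace_quotient_space)
  interpret V: vectorspace "class_ring :: 'k ring" ?V
    using finB by (rule dim_supported)
  have TQ: "?T \<in> LinearCombinations.module_hom (class_ring :: 'k ring) ?V (quotient_space J)"
    unfolding LinearCombinations.module_hom_def
    using carrier_quotient_space[OF J(1)] add_quotient_space[OF J(1)] smult_quotient_space[OF J(1)]
    by (auto simp: mpoly_space_simps)
  interpret VQ: mod_hom "class_ring :: 'k ring" ?V "quotient_space J" ?T
    by unfold_locales (rule TQ)
  have "VQ.im = quotient_part w J k"
    by (simp add: VQ.im_def part)
  then have "submodule class_ring (quotient_part w J k) (quotient_space J)"
    using VQ.im_is_submodule by simp
  then have "vectorspace class_ring ?W"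
    using J(1) by (intro Q.subspace_is_vs subspace.intro vectorspace_quotient_space)
  then interpret W: vectorspace "class_ring :: 'k ring" ?W .
  \<comment> \<open>The codomain is cut down to the image, so that surjectivity holds and the
    dimensions can be compared.\<close>
  interpret VW: linear_map "class_ring :: 'k ring" ?V ?W ?T
  proof unfold_locales
    show "?T \<in> LinearCombinations.module_hom (class_ring :: 'k ring) ?V ?W"
      using TQ by (auto simp: LinearCombinations.module_hom_def part)
  qed
  have "V.dim = W.dim"
  proof (rule VW.dim_eq)
    show "V.fin_dim" using finB by (rule dim_supported)
    show "inj_on ?T (carrier ?V)"
    proof (rule inj_onI)
      fix f g assume fg: "f \<in> carrier ?V" "g \<in> carrier ?V" "?T f = ?T g"
      then have "f - g \<in> J" using coset_eq_iff[OF J(1)] by blast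
      \<comment> \<open>For injectivity, the support of \<open>f - g\<close> lies in
        \<open>U\<close>, as the cosets agree, and also in \<open>?B\<close>, which is disjoint from
        \<open>U\<close>.\<close>
      then have "Poly_Mapping.keys (f - g) \<subseteq> U" by (simp add: J(2) supported_def)
      moreover have "f + - g \<in> supported ?B"
        using fg by (intro add_supported uminus_supported) auto
      then have "Poly_Mapping.keys (f - g) \<subseteq> ?B" by (simp add: supported_def)
      ultimately have "Poly_Mapping.keys (f - g) = {}" by blast
      then show "f = g" by simp
    qed
    show "?T ` carrier ?V = carrier ?W" by (simp add: part)
  qed
  then show ?thesis
    unfolding hilbert_function_def using dim_supported(3)[OF finB, where ?'k = 'k] by simp
qed

section \<open>Hilbert quasi-polynomials\<close>

text \<open>Either the value 0 is taken at arbitrarily large integers, or from some point on only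
  the value 1 is available. In both cases the polynomial agrees with a constant at infinitely many
  points.\<close>

lemma poly_frequently_01:
  assumes "\<And>K. \<exists>k\<ge>K::nat. poly p (of_nat k) \<in> {0, 1 :: rat}"
  shows "p \<in> {0, 1}"
proof (cases "\<forall>K. \<exists>k\<ge>K. poly p (of_nat k) = 0")
  case True
  then show ?thesis
    using poly_eqI_frequently[of p 0] by simp
next
  case False
  then obtain K where K: "\<And>k. k \<ge> K \<Longrightarrow> poly p (of_nat k) \<noteq> 0" by blast
  have "\<exists>k\<ge>K'. poly p (of_nat k) = 1" for K'
    using assms[of "max K K'"] K by auto
  then show ?thesis
    using poly_eqI_frequently[of p 1] by simp
qed

lemma exists_ge_mod_eq:
  assumes "i < (d::nat)"
  shows "\<exists>k\<ge>K. k mod d = i"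
proof -
  have "K * 1 \<le> K * d" using assms by (intro mult_le_mono2) simp
  then have "K * d + i \<ge> K" by linarith
  moreover have "(K * d + i) mod d = i" using assms by simp
  ultimately show ?thesis by blast
qed

text \<open>This justifies the definite description: two candidates agree eventually on class
  \<open>i\<close>, which is infinite because \<open>i < period w\<close>, so they are
  equal.\<close>

lemma hilbert_quasi_poly:
  assumes H: "eventually_quasi_poly (period w) (\<lambda>k. of_nat (hilbert_function w J k))"
    and i: "i < period w"
  shows "\<forall>\<^sub>F k in sequentially. k mod period w = i \<longrightarrow>
    of_nat (hilbert_function w J k) = poly (hilbert_quasi_poly w J i) (of_nat k)"
proof -
  obtain p :: "rat poly" where p: "\<forall>\<^sub>F k in sequentially. k mod period w = i \<longrightarrow>
      of_nat (hilbert_function w J k) = poly p (of_nat k)"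
    using H unfolding eventually_quasi_poly_def by blast
  have "q = p" if q: "\<forall>\<^sub>F k in sequentially. k mod period w = i \<longrightarrow>
      of_nat (hilbert_function w J k) = poly q (of_nat k)" for q :: "rat poly"
  proof (rule poly_eqI_frequently)
    fix K
    from p q have "\<forall>\<^sub>F k in sequentially. k mod period w = i \<longrightarrow>
        poly q (of_nat k) = poly p (of_nat k)"
      by eventually_elim auto
    then obtain L where L: "\<And>k. k \<ge> L \<Longrightarrow> k mod period w = i \<Longrightarrow>
        poly q (of_nat k) = poly p (of_nat k)"
      unfolding eventually_sequentially by blast
    obtain k where "k \<ge> max K L" "k mod period w = i"
      using exists_ge_mod_eq[OF i] by blast
    then show "\<exists>k\<ge>K. poly q (of_nat k) = poly p (of_nat k)"
      using L by (intro exI[of _ k]) simp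
  qed
  then have "hilbert_quasi_poly w J i = p"
    unfolding hilbert_quasi_poly_def using p by (intro the_equality)
  with p show ?thesis by simp
qed

text \<open>The least index exists: each of the finitely many residue classes has a threshold, and
  finitely many eventual statements hold jointly.\<close>

lemma regularity_index:
  assumes H: "eventually_quasi_poly (period w) (\<lambda>k. of_nat (hilbert_function w J k))"
    and "period w > 0" and "k \<ge> regularity_index w J"
  shows "of_nat (hilbert_function w J k) = poly (hilbert_quasi_poly w J (k mod period w)) (of_nat k)"
proof -
  have "\<forall>\<^sub>F k in sequentially. \<forall>i\<in>{..<period w}. k mod period w = i \<longrightarrow>
      of_nat (hilbert_function w J k) = poly (hilbert_quasi_poly w J i) (of_nat k)"
    using hilbert_quasi_poly[OF H] by (intro eventually_ball_finite) auto
  then have "\<exists>k0. \<forall>k\<ge>k0. of_nat (hilbert_function w J k)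
      = poly (hilbert_quasi_poly w J (k mod period w)) (of_nat k)"
    using \<open>period w > 0\<close> unfolding eventually_sequentially by fastforce
  from LeastI_ex[OF this, folded regularity_index_def] show ?thesis
    using \<open>k \<ge> regularity_index w J\<close> by blast
qed

section \<open>The equivalence for the Hilbert staircase\<close>

theorem theorem8:
  fixes w :: "'n::finite \<Rightarrow> nat"
    and prec_M prec_W :: "'n monom \<Rightarrow> 'n monom \<Rightarrow> bool"
    and I J :: "('n, 'k::field) mpoly set"
  assumes "\<And>i. w i > 0"
    and "monomial_ordering prec_M"
    and "prec_W = weighted_ordering w prec_M"
    and "ideal I mpoly_ring"
    and "J = initial_ideal prec_W I"
  shows "(\<forall>m\<in>staircase prec_W I. \<forall>m'\<in>staircase prec_W I. m \<noteq> m' \<longrightarrow> weight w m \<noteq> weight w m')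
     \<longleftrightarrow>
     (\<forall>k<regularity_index w J. hilbert_function w J k \<in> {0, 1}) \<and>
     (\<forall>i<period w. hilbert_quasi_poly w J i \<in> {0, 1})"
proof -
  note ord = strict_order_weighted_ordering[OF assms(2), of w, folded assms(3)]
  let ?N = "staircase prec_W I" and ?H = "hilbert_function w J" and ?P = "hilbert_quasi_poly w J"
  have fin: "finite {m. weight w m = k}" for k
    using assms(1) by (rule finite_weight_eq)
  have J: "J = supported (- ?N)"
    and up: "\<And>a m. m \<in> - ?N \<Longrightarrow> a + m \<in> - ?N"
    unfolding assms(5) using initial_ideal_eq_supported[OF ord assms(4)] by blast+
  have "ideal J mpoly_ring"
    unfolding J using up by (rule ideal_supported)
  then have H: "?H k = card {m \<in> ?N. weight w m = k}" for k
    using hilbert_function_supported[OF _ J fin] by simp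
  have period: "period w > 0"
    using assms(1) by (auto simp: period_def Lcm_0_iff intro!: Nat.gr0I) (metis less_irrefl)
  have quasi: "eventually_quasi_poly (period w) (\<lambda>k. of_nat (?H k))"
    unfolding H using assms(1) period
  proof (rule count_eventually_quasi_poly)
    show "w i dvd period w" for i
      by (simp add: period_def)
    show "a \<in> ?N" if "a + b \<in> ?N" for a b
      using up[of a b] that by (auto simp: add.commute)
  qed
  \<comment> \<open>Condition (i) is read weight by weight: a finite set has at most one element iff
    any two of its elements coincide.\<close>
  have "(\<forall>m\<in>?N. \<forall>m'\<in>?N. m \<noteq> m' \<longrightarrow> weight w m \<noteq> weight w m') \<longleftrightarrow> (\<forall>k. ?H k \<in> {0, 1})"
  proof -
    have "?H k \<in> {0, 1} \<longleftrightarrow>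
        (\<forall>m\<in>?N. \<forall>m'\<in>?N. weight w m = k \<and> weight w m' = k \<longrightarrow> m = m')" for k
    proof -
      have "finite {m \<in> ?N. weight w m = k}"
        using fin[of k] by simp
      then have "card {m \<in> ?N. weight w m = k} \<le> Suc 0 \<longleftrightarrow>
          (\<forall>m\<in>?N. \<forall>m'\<in>?N. weight w m = k \<and> weight w m' = k \<longrightarrow> m = m')"
        by (auto simp: card_le_Suc0_iff_eq)
      then show ?thesis
        unfolding H by (auto simp: le_Suc_eq)
    qed
    then show ?thesis by metis
  qed
  also have "\<dots> \<longleftrightarrow> (\<forall>k<regularity_index w J. ?H k \<in> {0, 1}) \<and> (\<forall>i<period w. ?P i \<in> {0, 1})"
  proof (intro iffI conjI allI impI)
    fix i assume 01: "\<forall>k. ?H k \<in> {0, 1}" and i: "i < period w"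
    show "?P i \<in> {0, 1}"
    proof (rule poly_frequently_01)
      fix K
      \<comment> \<open>Beyond the regularity index, \<open>?P i\<close> takes the value
        \<open>?H k\<close> at every \<open>k\<close> in class \<open>i\<close>, and there are such
        \<open>k\<close> past any bound.\<close>
      obtain k where "k \<ge> max K (regularity_index w J)" "k mod period w = i"
        using exists_ge_mod_eq[OF i] by blast
      moreover from this have "poly (?P i) (of_nat k) = of_nat (?H k)"
        using regularity_index[OF quasi period, of k] by simp
      ultimately show "\<exists>k\<ge>K. poly (?P i) (of_nat k) \<in> {0, 1}"
        using 01 by (intro exI[of _ k]) auto
    qed
  next
    fix k assume 01: "(\<forall>k<regularity_index w J. ?H k \<in> {0, 1}) \<and> (\<forall>i<period w. ?P i \<in> {0, 1})"
    show "?H k \<in> {0, 1}"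
    proof (cases "k < regularity_index w J")
      case False
      \<comment> \<open>From the regularity index on, \<open>?H k\<close> is the value of a constant
        component; the comparison takes place in the rationals and returns to the naturals by
        injectivity of \<open>of_nat\<close>.\<close>
      then have "(of_nat (?H k) :: rat) = poly (?P (k mod period w)) (of_nat k)"
        using regularity_index[OF quasi period] by simp
      moreover have "?P (k mod period w) \<in> {0, 1}"
        using 01 period by simp
      ultimately have "(of_nat (?H k) :: rat) = of_nat 0 \<or> (of_nat (?H k) :: rat) = of_nat 1"
        by auto
      then show ?thesis by (simp only: of_nat_eq_iff) simp
    qed (use 01 in blast)
  qed blast
  finally show ?thesis .
qed

end
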